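(* Let $D\subset\mathbb{R}^{2}$ be a compact, convex, non-empty set. Then $D$ is obtuse if and only if $D$ is $s$-nontrivial for some real number $s>0$.
   Context: Identify $\mathbb{R}^2=\mathbb{C}$. For $x,v\in\mathbb{C}$ and an angle $\theta\geq 0$ put $$T_{v,\theta}(x):=\{x+r\cdot e^{i\phi}\cdot v:\phi\in[0,\theta]\text{ and }r\in[0,1]\}.$$ A subset $D\subset\mathbb{R}^2=\mathbb{C}$ is called obtuse if for every $x\in\partial D$ there exist $v\in\mathbb{C}\setminus\{0\}$ and an angle $\theta>\frac{\pi}{2}$ such that $T_{v,\theta}(x)\subset D$. For a subset $D\subset\mathbb{R}^2$ and $s\in\mathbb{R}$, $D$ is called $s$-trivial if there exists a square in $\mathbb{R}^{2}$ (in arbitrary position, not necessarily axis-parallel) with side length $t\in(0,s]$ such that all four vertices of the square lie outside the interior of $D$ while the center of the square lies in $D$. Otherwise $D$ is called $s$-nontrivial; that is, $D$ is $s$-nontrivial if for every square with side length $t\in(0,s]$ and with center in $D$, at least one vertex of the square lies in the interior of $D$. *)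

theory Defs
  imports "HOL-Analysis.Analysis"
begin

text \<open>The plane is the type \<^typ>\<open>complex\<close> throughout.\<close>

definition sector :: "complex \<Rightarrow> real \<Rightarrow> complex \<Rightarrow> complex set" where
  "sector v \<theta> x =
     {x + complex_of_real r * exp (\<i> * complex_of_real \<phi>) * v | r \<phi>. \<phi> \<in> {0..\<theta>} \<and> r \<in> {0..1}}"

definition obtuse :: "complex set \<Rightarrow> bool" where
  "obtuse D \<longleftrightarrow>
     (\<forall>x\<in>frontier D. \<exists>v \<theta>. v \<noteq> 0 \<and> \<theta> > pi / 2 \<and> sector v \<theta> x \<subseteq> D)"

text \<open>
  A square in arbitrary position is given by one vertex \<open>p\<close> and the side vector \<open>u\<close>
  leading to the next vertex in counterclockwise order; the side length is \<open>norm u\<close>.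
  The square is nondegenerate when \<open>u\<close> is nonzero.
\<close>

definition square_vertices :: "complex \<Rightarrow> complex \<Rightarrow> complex set" where
  "square_vertices p u = {p, p + u, p + u + \<i> * u, p + \<i> * u}"

definition square_center :: "complex \<Rightarrow> complex \<Rightarrow> complex" where
  "square_center p u = p + (u + \<i> * u) / 2"

definition s_trivial :: "real \<Rightarrow> complex set \<Rightarrow> bool" where
  "s_trivial s D \<longleftrightarrow>
     (\<exists>p u. norm u \<in> {0<..s} \<and> square_vertices p u \<inter> interior D = {} \<and> square_center p u \<in> D)"

definition s_nontrivial :: "real \<Rightarrow> complex set \<Rightarrow> bool" where
  "s_nontrivial s D \<longleftrightarrow> \<not> s_trivial s D"

end

theory Submission imports Defs begin

text \<open>
  Both properties say the same thing about the cone \<open>K\<^sub>x\<close> of directions that lead from a point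
  \<open>x\<close> of \<open>D\<close> into the interior of \<open>D\<close>: every cross of four perpendicular rays at the origin
  has a ray in \<open>K\<^sub>x\<close>. An open convex cone does this exactly when its opening angle
  exceeds a right angle.

  For obtuseness, a sector wider than a right angle contains a triangle whose angle at \<open>x\<close>
  is obtuse, and one ray of each cross enters the interior of that triangle
  (\<open>sector_imp_meets_every_cross\<close>). Conversely, at a boundary point the cone \<open>K\<^sub>x\<close> is
  disjoint from \<open>-K\<^sub>x\<close>. If it were also disjoint from \<open>\<i>K\<^sub>x\<close>, then \<open>K\<^sub>x\<close> and the union of its
  three other quarter-turn rotations would be a partition of the punctured plane into
  nonempty open sets, which contradicts connectedness (\<open>open_cross_cover_quarter_turn\<close>). So \<open>K\<^sub>x\<close>
  contains two perpendicular directions, and, being open, two directions at a slightly larger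
  angle; convexity fills in a sector between them.

  For nontriviality, the vertices of a square with center \<open>x\<close> lie on the rays of a cross,
  all at the same distance from \<open>x\<close>. If small squares always have a vertex in the interior,
  then every cross meets \<open>K\<^sub>x\<close>. Conversely, by convexity, a ray from \<open>x\<close> that
  hits the interior at distance \<open>t\<close> stays in the interior at all positive distances up to \<open>t\<close>.
  The distance \<open>t\<close> can be chosen uniformly in \<open>x\<close> and in the orientation of the cross,
  because the center and the orientation range over the compact set
  \<open>D \<times> sphere 0 1\<close> (\<open>meets_every_cross_imp_s_nontrivial\<close>).
\<close>

section \<open>Directions into the interior\<close>

definition inward :: "complex set \<Rightarrow> complex \<Rightarrow> complex set" where
  "inward D x = {w. \<exists>t>0. x + of_real t * w \<in> interior D}"

text \<open>
  The four points \<open>z * u\<close> are the quarter-turn rotations of \<open>u\<close>, that is, the vertices of a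
  square centered at the origin.
\<close>

definition meets_every_cross :: "complex set \<Rightarrow> bool" where
  "meets_every_cross K \<longleftrightarrow> (\<forall>u. u \<noteq> 0 \<longrightarrow> (\<exists>z\<in>{1, \<i>, -1, -\<i>}. z * u \<in> K))"

lemma open_inward: "open (inward D x)"
proof -
  have "inward D x = (\<Union>t\<in>{0<..}. (\<lambda>w. x + of_real t * w) -` interior D)"
    by (auto simp: inward_def)
  then show ?thesis
    by (auto intro!: open_UN open_vimage continuous_intros)
qed

lemma inward_of_interior:
  assumes "x \<in> interior D"
  shows "inward D x = UNIV"
proof -
  have "w \<in> inward D x" for w
  proof -
    have "((\<lambda>t. x + of_real t * w) \<longlongrightarrow> x + of_real 0 * w) (at_right (0::real))"
      by (intro tendsto_intros)
    then have "\<forall>\<^sub>F t in at_right (0::real). x + of_real t * w \<in> interior D"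
      using assms by (auto intro: topological_tendstoD)
    then have "\<forall>\<^sub>F t in at_right (0::real). t > 0 \<and> x + of_real t * w \<in> interior D"
      using eventually_at_right_less by (rule eventually_conj[rotated])
    then show ?thesis
      unfolding inward_def using eventually_happens' trivial_limit_at_right_real by fast
  qed
  then show ?thesis by auto
qed

text \<open>
  Apart from its end \<open>x\<close>, a segment from a point of a convex set to an interior point stays
  in the interior. Hence a distance that works for a direction can be replaced by any smaller one.
\<close>

lemma interior_segment_shrink:
  fixes w :: complex
  assumes "convex D" "x \<in> D" "x + of_real t * w \<in> interior D" "0 < r" "r \<le> t"
  shows "x + of_real r * w \<in> interior D"
proof -
  define e where "e = r / t"
  have e: "0 < e" "e \<le> 1" using assms by (auto simp: e_def)
  have "x - e *\<^sub>R (x - (x + of_real t * w)) \<in> interior D"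
    using mem_interior_convex_shrink[OF assms(1,3,2) e] .
  moreover have "e *\<^sub>R (of_real t * w) = of_real r * w"
    using assms by (simp add: e_def scaleR_conv_of_real)
  ultimately show ?thesis by simp
qed

text \<open>
  If both \<open>w\<close> and \<open>-w\<close> led into the interior, then \<open>x\<close> would lie between two interior points.
\<close>

lemma inward_antisymmetric:
  assumes "convex D" "x \<notin> interior D" "w \<in> inward D x"
  shows "-w \<notin> inward D x"
proof
  assume "-w \<in> inward D x"
  then obtain s where s: "s > 0" "x + of_real s * (-w) \<in> interior D"
    by (auto simp: inward_def)
  obtain t where t: "t > 0" "x + of_real t * w \<in> interior D"
    using assms(3) by (auto simp: inward_def)
  have "convex (interior D)"
    using assms(1) by (rule convex_interior)
  \<comment> \<open>The weights are inversely proportional to the distances from \<open>x\<close>, so that \<open>w\<close> cancels.\<close>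
  then have "(s / (s + t)) *\<^sub>R (x + of_real t * w) + (t / (s + t)) *\<^sub>R (x + of_real s * (-w)) \<in> interior D"
    using s t by (intro convexD) (auto simp flip: add_divide_distrib)
  also have "(s / (s + t)) *\<^sub>R (x + of_real t * w) + (t / (s + t)) *\<^sub>R (x + of_real s * (-w))
      = (s / (s + t) + t / (s + t)) *\<^sub>R x + (s / (s + t) * t - t / (s + t) * s) *\<^sub>R w"
    by (simp only: scaleR_conv_of_real of_real_add of_real_diff of_real_mult) algebra
  also have "\<dots> = x"
    using s t by (simp add: mult.commute flip: add_divide_distrib)
  finally show False using assms(2) by simp
qed

section \<open>Obtuseness in terms of crosses\<close>

text \<open>
  The four rotations of a half-open quadrant tile the punctured plane. The side of the quadrant
  that is included must be the one on the imaginary axis: the strictly positive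
  combinations of \<open>1\<close> and \<open>cis \<theta>\<close> omit the positive real axis, but if \<open>\<theta>\<close> is an obtuse angle
  they include the positive imaginary axis.
\<close>

lemma rotate_into_quadrant:
  fixes u :: complex
  assumes "u \<noteq> 0"
  shows "\<exists>z\<in>{1, \<i>, -1, -\<i>}. Re (z * u) \<ge> 0 \<and> Im (z * u) > 0"
proof -
  consider "Re u \<ge> 0" "Im u > 0" | "Re u > 0" "Im u \<le> 0" | "Re u \<le> 0" "Im u < 0" | "Re u < 0" "Im u \<ge> 0"
    using assms by (force simp: complex_eq_iff)
  then show ?thesis by cases simp_all
qed

text \<open>
  By convexity, \<open>D\<close> contains the triangle with corners \<open>x\<close>, \<open>x + v\<close> and \<open>x + cis \<theta>' * v\<close> for an
  obtuse angle \<open>\<theta>'\<close>. Its interior is the set of strictly positive convex combinations of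
  the corners, and it is entered by every ray in the quadrant of the previous lemma,
  turned by the argument of \<open>v\<close>.
\<close>

lemma sector_imp_meets_every_cross:
  assumes "convex D" "v \<noteq> 0" "\<theta> > pi / 2" "sector v \<theta> x \<subseteq> D"
  shows "meets_every_cross (inward D x)"
  unfolding meets_every_cross_def
proof (intro allI impI)
  fix u :: complex
  assume "u \<noteq> 0"
  \<comment> \<open>The given angle may reach or exceed \<open>pi\<close>, where the triangle degenerates or turns over.\<close>
  define \<theta>' where "\<theta>' = min \<theta> (3 * pi / 4)"
  have \<theta>': "pi / 2 < \<theta>'" "\<theta>' < pi" "\<theta>' \<le> \<theta>"
    using assms(3) pi_gt_zero by (auto simp: \<theta>'_def min_def)
  define c s where "c = - cos \<theta>'" and "s = sin \<theta>'"
  have "s > 0"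
    unfolding s_def using \<theta>' pi_gt_zero by (intro sin_gt_zero) auto
  have "cos \<theta>' < cos (pi / 2)"
    using \<theta>' pi_gt_zero by (intro cos_monotone_0_pi) auto
  then have "c > 0" by (simp add: c_def)
  have cis: "cis \<theta>' = Complex (-c) s" by (simp add: c_def s_def cis.code)
  have in_sector: "x + of_real r * cis \<phi> * v \<in> D" if "0 \<le> r" "r \<le> 1" "0 \<le> \<phi>" "\<phi> \<le> \<theta>" for r \<phi>
    using that assms(4) unfolding sector_def cis_conv_exp by fastforce
  have corners: "x \<in> D" "x + v \<in> D" "x + cis \<theta>' * v \<in> D"
    using in_sector[of 0 0] in_sector[of 1 0] in_sector[of 1 \<theta>'] \<theta>' pi_gt_zero by auto
  have "\<not> collinear {0, v, cis \<theta>' * v}"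
  proof
    assume "collinear {0, v, cis \<theta>' * v}"
    then obtain k where "cis \<theta>' * v = k *\<^sub>R v"
      using assms(2) by (auto simp: collinear_lemma)
    then have "cis \<theta>' = of_real k"
      using assms(2) by (simp add: scaleR_conv_of_real)
    then show False using \<open>s > 0\<close> by (simp add: cis complex_eq_iff)
  qed
  then have triangle: "\<not> collinear {x, x + v, x + cis \<theta>' * v}"
    using collinear_3[of "x + v" x "x + cis \<theta>' * v"] by (simp add: insert_commute)
  obtain z where z: "z \<in> {1, \<i>, -1, -\<i>}" "Re (z * (u / v)) \<ge> 0" "Im (z * (u / v)) > 0"
    using rotate_into_quadrant[of "u / v"] \<open>u \<noteq> 0\<close> assms(2) divide_eq_0_iff by blast
  define p q where "p = Re (z * (u / v))" and "q = Im (z * (u / v))"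
  have pq: "p \<ge> 0" "q > 0" using z by (auto simp: p_def q_def)
  have "z * (u / v) = Complex p q" by (simp add: p_def q_def)
  then have zu: "z * u = Complex p q * v" using assms(2) by (simp add: field_simps)
  \<comment> \<open>The coordinates of \<open>Complex p q\<close> in the basis \<open>1\<close>, \<open>cis \<theta>'\<close>. Here \<open>\<alpha>\<close> is positive even for
    \<open>p = 0\<close>, because the angle is obtuse and hence \<open>c > 0\<close>.\<close>
  define \<alpha> \<beta> where "\<alpha> = p + c * q / s" and "\<beta> = q / s"
  have \<alpha>\<beta>: "\<alpha> > 0" "\<beta> > 0"
    using pq \<open>c > 0\<close> \<open>s > 0\<close> by (auto simp: \<alpha>_def \<beta>_def add_nonneg_pos)
  have combination: "Complex p q = of_real \<alpha> + of_real \<beta> * cis \<theta>'"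
    using \<open>s > 0\<close> by (simp add: cis complex_eq_iff \<alpha>_def \<beta>_def)
  \<comment> \<open>This scaling makes the weights \<open>t\<close>, \<open>t * \<alpha>\<close> and \<open>t * \<beta>\<close> of the three corners sum to \<open>1\<close>.\<close>
  define t where "t = 1 / (1 + \<alpha> + \<beta>)"
  have t: "t > 0" "t * (1 + \<alpha> + \<beta>) = 1" using \<alpha>\<beta> by (auto simp: t_def)
  have eq: "x + of_real t * (z * u)
      = t *\<^sub>R x + (t * \<alpha>) *\<^sub>R (x + v) + (t * \<beta>) *\<^sub>R (x + cis \<theta>' * v)"
  proof -
    have "t *\<^sub>R x + (t * \<alpha>) *\<^sub>R (x + v) + (t * \<beta>) *\<^sub>R (x + cis \<theta>' * v)
       = of_real (t * (1 + \<alpha> + \<beta>)) * x + of_real t * ((of_real \<alpha> + of_real \<beta> * cis \<theta>') * v)"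
      by (simp add: scaleR_conv_of_real algebra_simps)
    then show ?thesis using t(2) zu combination by simp
  qed
  have "x + of_real t * (z * u) \<in> interior (convex hull {x, x + v, x + cis \<theta>' * v})"
    unfolding interior_convex_hull_3_minimal[OF triangle DIM_complex]
    using eq t \<alpha>\<beta>
    by (intro CollectI exI[of _ t] exI[of _ "t * \<alpha>"] exI[of _ "t * \<beta>"]) (auto simp: algebra_simps)
  also have "\<dots> \<subseteq> interior D"
    using corners assms(1) by (intro interior_mono hull_minimal) auto
  finally show "\<exists>z\<in>{1, \<i>, -1, -\<i>}. z * u \<in> inward D x"
    using z(1) t(1) unfolding inward_def by blast
qed

text \<open>
  Connectedness of the punctured plane replaces any discussion of the opening angle of \<open>K\<close>:
  otherwise \<open>K\<close> and the union \<open>L\<close> of its three other rotations would be disjoint nonempty open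
  sets that cover the punctured plane.
\<close>

lemma open_cross_cover_quarter_turn:
  fixes K :: "complex set"
  assumes "open K" "meets_every_cross K" "0 \<notin> K" "\<And>w. w \<in> K \<Longrightarrow> -w \<notin> K"
  shows "\<exists>w\<in>K. \<i> * w \<in> K"
proof (rule ccontr)
  assume none: "\<not> ?thesis"
  define L where "L = (\<Union>z\<in>{\<i>, -1, -\<i>}. (\<lambda>w. z * w) -` K)"
  have "open L"
    unfolding L_def using assms(1) by (auto intro!: open_vimage continuous_intros)
  have "- {0} \<subseteq> K \<union> L"
    using assms(2) by (auto simp: meets_every_cross_def L_def)
  have disjoint: "K \<inter> L = {}"
  proof -
    have False if "w \<in> K" "-\<i> * w \<in> K" for w
      using none that(1) bexI[OF _ that(2), of "\<lambda>w. \<i> * w \<in> K"] by simp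
    then show ?thesis
      using none assms(4) by (fastforce simp: L_def)
  qed
  obtain z where z: "z \<in> {1, \<i>, -1, -\<i>}" "z \<in> K"
    using assms(2)[unfolded meets_every_cross_def, rule_format, of 1] by auto
  then have "z \<noteq> 0" by auto
  moreover have "-z \<in> L" using z by (simp add: L_def)
  ultimately have "K \<inter> - {0} \<noteq> {}" "L \<inter> - {0} \<noteq> {}" using z by auto
  moreover have "connected (- {0::complex})"
    by (intro connected_punctured_universe) simp
  ultimately show False
    using connectedD[OF _ assms(1) \<open>open L\<close>] disjoint \<open>- {0} \<subseteq> K \<union> L\<close> by blast
qed

text \<open>
  For \<open>0 \<le> \<phi> \<le> \<theta> < pi\<close> both coefficients are nonnegative, which places \<open>cis \<phi>\<close> in the cone spanned
  by \<open>1\<close> and \<open>cis \<theta>\<close>.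
\<close>

lemma cis_conic_combination:
  assumes "sin \<theta> \<noteq> 0"
  shows "cis \<phi> = of_real (sin (\<theta> - \<phi>) / sin \<theta>) + of_real (sin \<phi> / sin \<theta>) * cis \<theta>"
  using assms by (simp add: complex_eq_iff sin_diff field_simps)

text \<open>
  A sector that is short enough fits into the triangle spanned by \<open>x\<close> and a point on each of its
  two bounding rays. Shrinking by the factor \<open>sin \<theta> / 2\<close> suffices: it turns the coefficients of
  \<open>cis_conic_combination\<close> into halves of sines, whose sum is at most \<open>1\<close>.
\<close>

lemma two_inward_directions_imp_sector:
  assumes "convex D" "x \<in> D" "0 < \<theta>" "\<theta> < pi" "w \<in> inward D x" "cis \<theta> * w \<in> inward D x" "w \<noteq> 0"
  shows "\<exists>v. v \<noteq> 0 \<and> sector v \<theta> x \<subseteq> D"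
proof -
  obtain t1 t2 where t12: "t1 > 0" "x + of_real t1 * w \<in> interior D"
      "t2 > 0" "x + of_real t2 * (cis \<theta> * w) \<in> interior D"
    using assms(5,6) by (auto simp: inward_def)
  define t where "t = min t1 t2"
  have "t > 0" using t12 by (simp add: t_def)
  have ends: "x + of_real t * w \<in> D" "x + of_real t * (cis \<theta> * w) \<in> D"
    using interior_segment_shrink[OF assms(1,2) t12(2) \<open>t > 0\<close>]
      interior_segment_shrink[OF assms(1,2) t12(4) \<open>t > 0\<close>] interior_subset
    by (auto simp: t_def)
  have "sin \<theta> > 0" using assms by (intro sin_gt_zero) auto
  define v where "v = of_real (sin \<theta> / 2 * t) * w"
  have "v \<noteq> 0" using \<open>t > 0\<close> \<open>sin \<theta> > 0\<close> assms(7) by (simp add: v_def)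
  have in_D: "x + of_real r * exp (\<i> * of_real \<phi>) * v \<in> D"
    if "0 \<le> \<phi>" "\<phi> \<le> \<theta>" "0 \<le> r" "r \<le> 1" for r \<phi>
  proof -
    define a b where "a = r * sin (\<theta> - \<phi>) / 2" and "b = r * sin \<phi> / 2"
    have "sin (\<theta> - \<phi>) \<ge> 0" "sin \<phi> \<ge> 0"
      using that assms by (auto intro!: sin_ge_zero)
    then have ab: "a \<ge> 0" "b \<ge> 0" using that by (auto simp: a_def b_def)
    have "a \<le> 1 * 1 / 2" "b \<le> 1 * 1 / 2"
      unfolding a_def b_def using that \<open>sin (\<theta> - \<phi>) \<ge> 0\<close> \<open>sin \<phi> \<ge> 0\<close>
      by (intro divide_right_mono mult_mono; simp)+
    then have "a + b \<le> 1" by simp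
    have "of_real (sin \<theta>) * cis \<phi> = of_real (sin (\<theta> - \<phi>)) + of_real (sin \<phi>) * cis \<theta>"
      using \<open>sin \<theta> > 0\<close> by (subst cis_conic_combination[of \<theta> \<phi>]) (auto simp: field_simps)
    then have "of_real (r / 2 * t) * (of_real (sin \<theta>) * cis \<phi>) * w
      = of_real (r / 2 * t) * (of_real (sin (\<theta> - \<phi>)) + of_real (sin \<phi>) * cis \<theta>) * w"
      by simp
    then have "of_real r * cis \<phi> * v = of_real a * (of_real t * w) + of_real b * (of_real t * (cis \<theta> * w))"
      by (simp add: v_def a_def b_def algebra_simps)
    then have "x + of_real r * exp (\<i> * of_real \<phi>) * v
        = (1 - (a + b)) *\<^sub>R x + a *\<^sub>R (x + of_real t * w) + b *\<^sub>R (x + of_real t * (cis \<theta> * w))"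
      by (simp add: cis_conv_exp[symmetric] scaleR_conv_of_real algebra_simps)
    also have "\<dots> \<in> convex hull {x, x + of_real t * w, x + of_real t * (cis \<theta> * w)}"
      unfolding convex_hull_3 using ab \<open>a + b \<le> 1\<close>
      by (intro CollectI exI[of _ "1 - (a + b)"] exI[of _ a] exI[of _ b]) auto
    also have "\<dots> \<subseteq> D"
      using assms(1,2) ends by (intro hull_minimal) auto
    finally show ?thesis .
  qed
  have "sector v \<theta> x \<subseteq> D"
    unfolding sector_def using in_D by (auto simp only: atLeastAtMost_iff)
  with \<open>v \<noteq> 0\<close> show ?thesis by blast
qed

lemma meets_every_cross_imp_sector:
  assumes "convex D" "x \<in> D" "x \<notin> interior D" "meets_every_cross (inward D x)"
  shows "\<exists>v \<theta>. v \<noteq> 0 \<and> \<theta> > pi / 2 \<and> sector v \<theta> x \<subseteq> D"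
proof -
  have "0 \<notin> inward D x" using assms(3) by (simp add: inward_def)
  then obtain w where w: "w \<in> inward D x" "\<i> * w \<in> inward D x"
    using open_cross_cover_quarter_turn[OF open_inward assms(4)] inward_antisymmetric[OF assms(1,3)]
    by blast
  have "w \<noteq> 0" using w \<open>0 \<notin> inward D x\<close> by auto
  have "((\<lambda>\<theta>. cis \<theta> * w) \<longlongrightarrow> cis (pi / 2) * w) (at_right (pi / 2))"
    by (intro tendsto_intros)
  then have "\<forall>\<^sub>F \<theta> in at_right (pi / 2). cis \<theta> * w \<in> inward D x"
    using w(2) open_inward by (auto intro: topological_tendstoD)
  moreover have "\<forall>\<^sub>F \<theta> in at_right (pi / 2). \<theta> \<in> {pi / 2 <..< pi}"
    by (intro eventually_at_right_real) simp
  ultimately have "\<forall>\<^sub>F \<theta> in at_right (pi / 2). cis \<theta> * w \<in> inward D x \<and> \<theta> \<in> {pi / 2 <..< pi}"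
    by (rule eventually_conj)
  then obtain \<theta> where \<theta>: "cis \<theta> * w \<in> inward D x" "pi / 2 < \<theta>" "\<theta> < pi"
    using eventually_happens' trivial_limit_at_right_real by fastforce
  moreover have "0 < \<theta>" using \<theta>(2) pi_gt_zero by linarith
  ultimately show ?thesis
    using two_inward_directions_imp_sector[OF assms(1,2) _ _ w(1) _ \<open>w \<noteq> 0\<close>] by blast
qed

text \<open>
  Obtuseness is a condition on boundary points only, but at interior points every direction
  leads into the interior, so the cross condition may be required on all of \<open>D\<close>.
\<close>

lemma obtuse_iff_meets_every_cross:
  assumes "closed D" "convex D"
  shows "obtuse D \<longleftrightarrow> (\<forall>x\<in>D. meets_every_cross (inward D x))"
proof
  assume obtuse: "obtuse D"
  show "\<forall>x\<in>D. meets_every_cross (inward D x)"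
  proof
    fix x assume "x \<in> D"
    show "meets_every_cross (inward D x)"
    proof (cases "x \<in> interior D")
      case True
      then show ?thesis by (auto simp: inward_of_interior meets_every_cross_def)
    next
      case False
      then have "x \<in> frontier D"
        using \<open>x \<in> D\<close> closure_subset by (auto simp: frontier_def)
      then show ?thesis
        using obtuse sector_imp_meets_every_cross[OF assms(2)] unfolding obtuse_def by blast
    qed
  qed
next
  assume "\<forall>x\<in>D. meets_every_cross (inward D x)"
  then show "obtuse D"
    using meets_every_cross_imp_sector[OF assms(2)] assms(1)
    by (auto simp: obtuse_def frontier_def)
qed

section \<open>Nontriviality in terms of crosses\<close>

text \<open>
  The factor \<open>(1 + \<i>) / 2\<close> turns the side vector into half of a diagonal.
\<close>

lemma square_vertices_from_center:
  "square_vertices p u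
    = (\<lambda>z. square_center p u + z * ((1 + \<i>) / 2 * u)) ` {1, \<i>, -1, -\<i>}"
proof -
  have eqs: "square_center p u + 1 * ((1 + \<i>) / 2 * u) = p + u + \<i> * u"
    "square_center p u + \<i> * ((1 + \<i>) / 2 * u) = p + \<i> * u"
    "square_center p u + (-1) * ((1 + \<i>) / 2 * u) = p"
    "square_center p u + (-\<i>) * ((1 + \<i>) / 2 * u) = p + u"
    by (simp_all add: square_center_def complex_eq_iff field_simps)
  show ?thesis
    unfolding image_insert image_empty eqs square_vertices_def by auto
qed

text \<open>
  Parametrizing squares by the center \<open>c\<close> and half of a diagonal \<open>h\<close> instead of a vertex and
  a side turns the vertices into the tips of a cross; the side length is then
  \<open>sqrt 2 * norm h\<close>.
\<close>

lemma s_nontrivial_iff_crosses: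
  "s_nontrivial s D \<longleftrightarrow>
    (\<forall>c\<in>D. \<forall>h. 0 < norm h \<and> sqrt 2 * norm h \<le> s \<longrightarrow> (\<exists>z\<in>{1, \<i>, -1, -\<i>}. c + z * h \<in> interior D))"
    (is "_ \<longleftrightarrow> ?crosses")
proof
  assume crosses: ?crosses
  have "square_vertices p u \<inter> interior D \<noteq> {}"
    if side: "norm u \<in> {0<..s}" and center: "square_center p u \<in> D" for p u
  proof -
    have "norm ((1 + \<i>) / 2) = 1 / sqrt 2"
      by (simp add: cmod_def power2_eq_square real_sqrt_divide field_simps)
    then have "norm ((1 + \<i>) / 2 * u) = norm u / sqrt 2"
      by (simp only: norm_mult) simp
    then have "0 < norm ((1 + \<i>) / 2 * u) \<and> sqrt 2 * norm ((1 + \<i>) / 2 * u) \<le> s"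
      using side by simp
    then obtain z where "z \<in> {1, \<i>, -1, -\<i>}"
        "square_center p u + z * ((1 + \<i>) / 2 * u) \<in> interior D"
      using crosses center by blast
    then show ?thesis
      unfolding square_vertices_from_center by blast
  qed
  then show "s_nontrivial s D"
    unfolding s_nontrivial_def s_trivial_def by blast
next
  assume nontrivial: "s_nontrivial s D"
  show ?crosses
  proof (intro ballI allI impI)
    fix c h :: complex
    assume c: "c \<in> D" and h: "0 < norm h \<and> sqrt 2 * norm h \<le> s"
    define u p where "u = (1 - \<i>) * h" and "p = c - h"
    have diagonal: "(1 + \<i>) / 2 * u = h"
      by (simp add: u_def complex_eq_iff field_simps)
    have center: "square_center p u = c"
      by (simp add: u_def p_def square_center_def complex_eq_iff field_simps)
    have "norm (1 - \<i>) = sqrt 2" by (simp add: cmod_def)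
    then have "norm u \<in> {0<..s}" using h by (simp add: u_def norm_mult)
    then have "square_vertices p u \<inter> interior D \<noteq> {}"
      using nontrivial c center unfolding s_nontrivial_def s_trivial_def by blast
    then show "\<exists>z\<in>{1, \<i>, -1, -\<i>}. c + z * h \<in> interior D"
      unfolding square_vertices_from_center center diagonal by blast
  qed
qed

text \<open>
  Scaling \<open>u\<close> to the half-diagonal of a square of side length \<open>s\<close> does not change the directions
  of its cross.
\<close>

lemma s_nontrivial_imp_meets_every_cross:
  assumes "s > 0" "s_nontrivial s D" "x \<in> D"
  shows "meets_every_cross (inward D x)"
  unfolding meets_every_cross_def
proof (intro allI impI)
  fix u :: complex
  assume "u \<noteq> 0"
  define t where "t = s / (sqrt 2 * norm u)"
  have "t > 0" using assms(1) \<open>u \<noteq> 0\<close> by (simp add: t_def)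
  then have "norm (of_real t * u) = t * norm u" by (simp add: norm_mult)
  moreover have "sqrt 2 * (t * norm u) = s" using \<open>u \<noteq> 0\<close> by (simp add: t_def)
  ultimately have "0 < norm (of_real t * u) \<and> sqrt 2 * norm (of_real t * u) \<le> s"
    using \<open>t > 0\<close> \<open>u \<noteq> 0\<close> by simp
  then obtain z where "z \<in> {1, \<i>, -1, -\<i>}" "x + z * (of_real t * u) \<in> interior D"
    using assms(2,3) unfolding s_nontrivial_iff_crosses by blast
  then show "\<exists>z\<in>{1, \<i>, -1, -\<i>}. z * u \<in> inward D x"
    using \<open>t > 0\<close> unfolding inward_def mem_Collect_eq mult.left_commute[of z] by blast
qed

text \<open>
  The set \<open>U t\<close> below consists of the pairs of a center and an orientation for which the distance
  \<open>t\<close> works. These sets are open and cover the compact set \<open>D \<times> sphere 0 1\<close>, so finitely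
  many distances suffice. Their minimum works everywhere, since distances can be shrunk.
\<close>

lemma meets_every_cross_imp_s_nontrivial:
  assumes "compact D" "convex D" "\<And>x. x \<in> D \<Longrightarrow> meets_every_cross (inward D x)"
  shows "\<exists>s>0. s_nontrivial s D"
proof -
  define U where "U t = (\<Union>z\<in>{1, \<i>, -1, -\<i>}. (\<lambda>(x, w). x + of_real t * (z * w)) -` interior D)"
    for t :: real
  have "compact (D \<times> sphere (0::complex) 1)"
    using assms(1) by (intro compact_Times) auto
  moreover have "open (U t)" for t
    unfolding U_def case_prod_unfold by (intro open_UN ballI open_vimage continuous_intros) auto
  moreover have "D \<times> sphere 0 1 \<subseteq> (\<Union>t\<in>{0<..}. U t)"
  proof clarify
    fix x w :: complex
    assume "x \<in> D" "w \<in> sphere 0 1"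
    then have "w \<noteq> 0" by auto
    then obtain z t where "z \<in> {1, \<i>, -1, -\<i>}" "t > 0" "x + of_real t * (z * w) \<in> interior D"
      using assms(3)[OF \<open>x \<in> D\<close>] unfolding meets_every_cross_def inward_def by blast
    then show "(x, w) \<in> (\<Union>t\<in>{0<..}. U t)" unfolding U_def by auto
  qed
  ultimately obtain T where T: "T \<subseteq> {0<..}" "finite T" "D \<times> sphere 0 1 \<subseteq> (\<Union>t\<in>T. U t)"
    by (rule compactE_image)
  \<comment> \<open>Inserting \<open>1\<close> keeps the minimum meaningful when \<open>T\<close> is empty.\<close>
  define s where "s = Min (insert 1 T)"
  have s_le: "s \<le> t" if "t \<in> T" for t
    using T(2) that by (simp add: s_def)
  have "s > 0" using T(1,2) by (auto simp: s_def)
  have "\<exists>z\<in>{1, \<i>, -1, -\<i>}. c + z * h \<in> interior D"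
    if "c \<in> D" "0 < norm h \<and> sqrt 2 * norm h \<le> s" for c h
  proof -
    define w where "w = sgn h"
    have h: "h = of_real (norm h) * w"
      using that by (simp add: w_def sgn_div_norm scaleR_conv_of_real)
    have "w \<in> sphere 0 1" using that by (simp add: w_def norm_sgn)
    then have "(c, w) \<in> (\<Union>t\<in>T. U t)" using T(3) \<open>c \<in> D\<close> by blast
    then obtain t z where tz: "t \<in> T" "z \<in> {1, \<i>, -1, -\<i>}" "c + of_real t * (z * w) \<in> interior D"
      unfolding U_def by (elim UN_E) simp
    have "1 * norm h \<le> sqrt 2 * norm h"
      by (intro mult_right_mono) auto
    then have "norm h \<le> t" using that s_le[OF tz(1)] by linarith
    then have "c + of_real (norm h) * (z * w) \<in> interior D"
      using interior_segment_shrink[OF assms(2) \<open>c \<in> D\<close> tz(3)] that by blast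
    then have "c + z * h \<in> interior D"
      by (subst h) (simp only: mult.left_commute)
    then show ?thesis using tz(2) by blast
  qed
  then show ?thesis
    using \<open>s > 0\<close> unfolding s_nontrivial_iff_crosses by blast
qed

section \<open>Equivalence of obtuseness and nontriviality\<close>

theorem lemma2p2:
  fixes D :: "complex set"
  assumes "compact D" and "convex D" and "D \<noteq> {}"
  shows "obtuse D \<longleftrightarrow> (\<exists>s::real. s > 0 \<and> s_nontrivial s D)"
  using obtuse_iff_meets_every_cross[OF compact_imp_closed[OF assms(1)] assms(2)]
    meets_every_cross_imp_s_nontrivial[OF assms(1,2)] s_nontrivial_imp_meets_every_cross
  by blast

end
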